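(* Let $0<p<\frac12$, and put $\beta=\frac{p}{2p-1}$ and $\gamma=\frac{1-p}{p}$. Let $(d_k)_{k=0}^\infty$ be the unique positive bounded sequence satisfying $$d_0=\frac{1-p}{p},\qquad d_k=\frac{pk\,d_{k-1}+(1-p)k\,d_{k+1}}{k+p}\quad (k\ge 1).$$ Then for all $k\ge 0$, $$d_k=\gamma^{-k}\int_0^1\frac{t^k(1-t)^{-1-\beta}}{(1-\gamma^{-1}t)^{1-\beta}}\,dt.$$ *)

theory Defs
  imports "HOL-Analysis.Analysis"
begin

definition positive_bounded_solution :: "real \<Rightarrow> (nat \<Rightarrow> real) \<Rightarrow> bool" where
  "positive_bounded_solution p d \<longleftrightarrow>
     (\<forall>k. 0 < d k) \<and> bounded (range d) \<and>
     d 0 = (1 - p) / p \<and>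
     (\<forall>k\<ge>1. d k = (p * real k * d (k - 1) + (1 - p) * real k * d (k + 1)) / (real k + p))"

end

theory Submission
  imports Defs
begin

text \<open>Write \<open>c = 1 / \<gamma>\<close>, \<open>u(t) = (1 - t) / (1 - c t)\<close> and let \<open>I\<^sub>k\<close> be the integral in
  question. The weight is a multiple of the derivative of \<open>u powr (- \<beta>)\<close>, so integrating by parts
  evaluates \<open>I\<^sub>0\<close> and turns \<open>I\<^sub>k\<close> into a multiple of the integral of
  \<open>k t^(k - 1) u powr (- \<beta>)\<close>; since \<open>u powr (- \<beta>)\<close> is also \<open>(1 - t) (1 - c t)\<close> times the
  weight, this is the recurrence for \<open>c^k I\<^sub>k\<close>. Uniqueness holds because the increments
  of the difference of two solutions decrease no faster than \<open>1 / k\<close>.\<close>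

section \<open>Calculus of the kernel \<open>t ^ k * u powr (- b)\<close>\<close>

lemma one_minus_mult_pos:
  fixes c t :: real
  assumes "0 < c" "c < 1" "t \<le> 1"
  shows "0 < 1 - c * t"
  using mult_left_mono[of t 1 c] assms by linarith

text \<open>Product rule: \<open>u' = (c - 1) / (1 - c * t) ^ 2\<close>, so the derivative of
  \<open>u powr (- b)\<close> is exactly \<open>b * (1 - c)\<close> times the weight.\<close>

lemma powr_kernel_deriv:
  fixes b c t :: real
  assumes "0 < t" "t < 1" "c < 1" "0 < c"
  shows "((\<lambda>t. t ^ k * ((1 - t) / (1 - c * t)) powr (- b)) has_real_derivative
     (real k * t ^ (k - 1) * ((1 - t) / (1 - c * t)) powr (- b)
       + b * (1 - c) * (t ^ k * (1 - t) powr (- 1 - b) / (1 - c * t) powr (1 - b)))) (at t)"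
proof -
  have pos: "0 < 1 - c * t" "0 < 1 - t"
    using assms one_minus_mult_pos[of c t] by auto
  \<comment> \<open>This brings the weight to the form that the chain rule produces, using
    \<open>1 - b = (- b - 1) + 2\<close>.\<close>
  have fac: "(1 - t) powr (- 1 - b) / (1 - c * t) powr (1 - b)
      = ((1 - t) / (1 - c * t)) powr (- b - 1) / (1 - c * t) ^ 2"
  proof -
    have "(1 - c * t) powr (1 - b) = (1 - c * t) powr (- b - 1) * (1 - c * t) ^ 2"
      using pos powr_add[of "1 - c * t" "- b - 1" 2] by simp
    then show ?thesis
      using pos by (simp add: powr_divide divide_simps)
        (simp add: algebra_simps minus_diff_commute[of b 1])
  qed
  have der_u: "((\<lambda>t. (1 - t) / (1 - c * t)) has_real_derivative ((c - 1) / (1 - c * t) ^ 2)) (at t)"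
    using pos by (auto intro!: derivative_eq_intros simp: power2_eq_square algebra_simps)
  have "((\<lambda>t. ((1 - t) / (1 - c * t)) powr (- b)) has_real_derivative
      (- b * ((1 - t) / (1 - c * t)) powr (- b - 1) * ((c - 1) / (1 - c * t) ^ 2))) (at t)"
    using DERIV_fun_powr[OF der_u, of "- b"] pos by simp
  from DERIV_mult[OF DERIV_pow[of k t UNIV] this] show ?thesis
    unfolding times_divide_eq_right[symmetric] fac
    by (rule DERIV_cong) (simp add: algebra_simps add_divide_distrib diff_divide_distrib)
qed

text \<open>The only delicate point is \<open>t = 1\<close>, where the base vanishes;
  \<open>- b > 0\<close> gives continuity there.\<close>

lemma powr_kernel_continuous:
  fixes b c :: real
  assumes "b < 0" "0 < c" "c < 1"
  shows "continuous_on {0..1} (\<lambda>t. t ^ k * ((1 - t) / (1 - c * t)) powr (- b))"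
proof -
  have pos: "0 < 1 - c * t" if "t \<in> {0..1}" for t
    using that assms one_minus_mult_pos[of c t] by auto
  then have ne: "c * t \<noteq> 1" if "t \<in> {0..1}" for t
    using that by force
  show ?thesis
    using assms pos by (intro continuous_intros continuous_on_powr') (auto simp: ne less_imp_le)
qed

text \<open>The weight may be singular at \<open>t = 1\<close>, so the derivative is used on the
  open interval only. The kernel is \<open>0\<close> at \<open>t = 1\<close> and
  \<open>0 ^ k\<close> at \<open>t = 0\<close>, that is \<open>1\<close> exactly when
  \<open>k = 0\<close>.\<close>

lemma powr_kernel_has_integral:
  fixes b c :: real
  assumes "b < 0" "0 < c" "c < 1"
  shows "((\<lambda>t. real k * t ^ (k - 1) * ((1 - t) / (1 - c * t)) powr (- b)
       + b * (1 - c) * (t ^ k * (1 - t) powr (- 1 - b) / (1 - c * t) powr (1 - b)))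
     has_integral (- (0 ^ k))) {0..1}"
  using fundamental_theorem_of_calculus_interior
    [OF zero_le_one powr_kernel_continuous[OF assms, of k]
        powr_kernel_deriv[of _ c k b, THEN has_real_derivative_iff_has_vector_derivative[THEN iffD1]]]
    assms by simp

section \<open>The Euler integral: integration by parts, positivity, recurrence\<close>

definition euler_integral :: "real \<Rightarrow> real \<Rightarrow> nat \<Rightarrow> real" where
  "euler_integral b c k = integral {0..1}
     (\<lambda>t. t ^ k * (1 - t) powr (- 1 - b) / (1 - c * t) powr (1 - b))"

text \<open>Integrability of the possibly singular integrand comes for free: it is, up to a nonzero
  constant, an integrable derivative minus a continuous function.\<close>

lemma euler_integral_by_parts:
  fixes b c :: real
  assumes "b < 0" "0 < c" "c < 1"
  shows "(\<lambda>t. t ^ k * (1 - t) powr (- 1 - b) / (1 - c * t) powr (1 - b)) integrable_on {0..1}"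
      (is "?f integrable_on _")
    and "- b * (1 - c) * euler_integral b c k
      = 0 ^ k + real k * integral {0..1} (\<lambda>t. t ^ (k - 1) * ((1 - t) / (1 - c * t)) powr (- b))"
proof -
  let ?g = "\<lambda>t. t ^ (k - 1) * ((1 - t) / (1 - c * t)) powr (- b)"
  have "(?g has_integral integral {0..1} ?g) {0..1}"
    using powr_kernel_continuous[OF assms] by (intro integrable_integral integrable_continuous_real)
  from has_integral_diff[OF powr_kernel_has_integral[OF assms, of k]
      has_integral_mult_right[OF this, of "real k"]]
  have "((\<lambda>t. b * (1 - c) * ?f t) has_integral (- (0 ^ k) - real k * integral {0..1} ?g)) {0..1}"
    by (simp add: mult.assoc)
  from has_integral_mult_right[OF this, of "1 / (b * (1 - c))"]
  have I: "(?f has_integral (- (0 ^ k) - real k * integral {0..1} ?g) / (b * (1 - c))) {0..1}"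
    using assms by simp
  then show "?f integrable_on {0..1}" by blast
  show "- b * (1 - c) * euler_integral b c k = 0 ^ k + real k * integral {0..1} ?g"
    unfolding euler_integral_def integral_unique[OF I] using assms by (simp add: field_simps)
qed

lemma euler_integral_0:
  assumes "b < 0" "0 < c" "c < 1"
  shows "euler_integral b c 0 = 1 / (- b * (1 - c))"
  using euler_integral_by_parts(2)[OF assms, of 0] assms by (simp add: field_simps)

text \<open>Integration by parts replaces the singular integrand by a continuous nonnegative one,
  whose integral vanishes only if the function does; \<open>t = 1/2\<close> shows that it does
  not.\<close>

lemma euler_integral_pos:
  assumes "b < 0" "0 < c" "c < 1"
  shows "0 < euler_integral b c k"
proof (cases "k = 0")
  case True
  then show ?thesis using assms by (simp add: euler_integral_0 mult_neg_pos)
next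
  case False
  let ?g = "\<lambda>t. t ^ (k - 1) * ((1 - t) / (1 - c * t)) powr (- b)"
  have "c / 2 < 1" using assms by simp
  then have nz: "?g (1/2) \<noteq> 0" by simp
  have "integral {0..1} ?g \<noteq> 0"
  proof
    assume "integral {0..1} ?g = 0"
    then have "\<forall>t\<in>{0..1}. ?g t = 0"
      by (subst (asm) integral_eq_0_iff[OF powr_kernel_continuous[OF assms]]) simp_all
    then have "?g (1/2) = 0" by (rule bspec) simp
    with nz show False ..
  qed
  moreover have "0 \<le> integral {0..1} ?g"
    by (intro integral_nonneg integrable_continuous_real powr_kernel_continuous assms) auto
  ultimately have "0 < integral {0..1} ?g" by linarith
  then have "0 < - b * (1 - c) * euler_integral b c k"
    unfolding euler_integral_by_parts(2)[OF assms] using False by (simp add: zero_power)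
  then show ?thesis
    using assms by (simp add: zero_less_mult_iff mult_less_0_iff)
qed

lemma euler_integral_le:
  assumes "b < 0" "0 < c" "c < 1"
  shows "euler_integral b c k \<le> euler_integral b c 0"
  unfolding euler_integral_def
  by (intro integral_le euler_integral_by_parts(1)[OF assms] divide_right_mono mult_right_mono)
     (auto simp: power_le_one)

text \<open>The coefficients are those of
  \<open>(1 - t) * (1 - c * t) = 1 - (1 + c) * t + c * t ^ 2\<close>. This factor turns
  \<open>t ^ k\<close> times the weight into the integrand left by integrating by parts at index
  \<open>Suc k\<close>.\<close>

lemma euler_integral_recurrence:
  assumes "b < 0" "0 < c" "c < 1"
  shows "real (Suc k) * (euler_integral b c k - (1 + c) * euler_integral b c (Suc k)
           + c * euler_integral b c (Suc (Suc k)))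
         = - b * (1 - c) * euler_integral b c (Suc k)"
proof -
  let ?f = "\<lambda>k t. t ^ k * (1 - t) powr (- 1 - b) / (1 - c * t) powr (1 - b)"
  have I: "(?f j has_integral euler_integral b c j) {0..1}" for j
    unfolding euler_integral_def
    using euler_integral_by_parts(1)[OF assms] by (rule integrable_integral)
  have eq: "?f k t - (1 + c) * ?f (Suc k) t + c * ?f (Suc (Suc k)) t
      = t ^ k * ((1 - t) / (1 - c * t)) powr (- b)" if "t \<in> {0..1}" for t
  proof -
    have pos: "0 < 1 - c * t" "0 \<le> 1 - t"
      using that assms one_minus_mult_pos[of c t] by auto
    have "(1 - c * t) powr (1 - b) = (1 - c * t) powr (- b) * (1 - c * t)"
      using pos powr_add[of "1 - c * t" "- b" 1] by simp
    \<comment> \<open>At \<open>t = 1\<close> both sides are \<open>0\<close>, since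
      \<open>0 powr x = 0\<close> even for negative \<open>x\<close>.\<close>
    moreover have "(1 - t) powr (- b) = (1 - t) powr (- 1 - b) * (1 - t)"
      using pos assms powr_add[of "1 - t" "- 1 - b" 1] by (cases "t = 1") auto
    moreover have "?f k t - (1 + c) * ?f (Suc k) t + c * ?f (Suc (Suc k)) t
      = t ^ k * ((1 - t) powr (- 1 - b) * (1 - t)) * (1 - c * t) / (1 - c * t) powr (1 - b)"
      using pos by (simp add: divide_simps) (simp add: algebra_simps)
    ultimately show ?thesis
      using pos by (simp add: powr_divide)
  qed
  have "((\<lambda>t. t ^ k * ((1 - t) / (1 - c * t)) powr (- b)) has_integral
      (euler_integral b c k - (1 + c) * euler_integral b c (Suc k)
           + c * euler_integral b c (Suc (Suc k)))) {0..1}"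
    by (rule has_integral_eq[OF eq has_integral_add[OF has_integral_diff[OF I
          has_integral_mult_right[OF I]] has_integral_mult_right[OF I]]])
  from integral_unique[OF this] show ?thesis
    by (simp only: euler_integral_by_parts(2)[OF assms, of "Suc k"]) simp
qed

section \<open>Uniqueness of the bounded solution\<close>

lemma solution_step:
  assumes "positive_bounded_solution p d" "0 < p"
  shows "(real (Suc k) + p) * d (Suc k)
    = p * real (Suc k) * d k + (1 - p) * real (Suc k) * d (Suc (Suc k))"
proof -
  have "d (Suc k) = (p * real (Suc k) * d k + (1 - p) * real (Suc k) * d (Suc (Suc k))) / (real (Suc k) + p)"
    using assms unfolding positive_bounded_solution_def by (metis Suc_eq_plus1 diff_Suc_1 le_add2)
  then show ?thesis using assms(2) by (simp add: field_simps)
qed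

text \<open>The increments of a solution that starts at \<open>0\<close> and then is positive
  dominate a multiple of the harmonic series, so such a solution is unbounded.\<close>

lemma recurrence_harm_bound:
  fixes e :: "nat \<Rightarrow> real"
  assumes p: "0 < p" "p < 1" and e0: "e 0 = 0" and e1: "0 \<le> e 1"
    and step: "\<And>k. (real (Suc k) + p) * e (Suc k)
      = p * real (Suc k) * e k + (1 - p) * real (Suc k) * e (Suc (Suc k))"
  shows "e n \<le> e (Suc n) \<and> e 1 * (1 + p / (1 - p) * harm n) \<le> e (Suc n)"
proof (induction n)
  case 0
  then show ?case using e0 e1 by (simp add: harm_def)
next
  case (Suc n)
  define N where "N = real (Suc n)"
  have N: "0 < N" by (simp add: N_def)
  have h: "0 \<le> e 1 * (p / (1 - p) * harm n)"
    using e1 p harm_nonneg[of n] by (intro mult_nonneg_nonneg) auto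
  with Suc have ge: "e 1 \<le> e (Suc n)" by (simp add: algebra_simps)
  \<comment> \<open>Splitting \<open>N = p * N + (1 - p) * N\<close> writes the recurrence in
    increments. The previous increment is nonnegative by induction, which is why monotonicity is
    part of the claim.\<close>
  have "(1 - p) * N * (e (Suc (Suc n)) - e (Suc n)) = p * N * (e (Suc n) - e n) + p * e (Suc n)"
    using step[of n] unfolding N_def[symmetric] by (simp add: algebra_simps)
  also have "\<dots> \<ge> 0 + p * e 1"
    using Suc ge N p by (intro add_mono mult_nonneg_nonneg mult_left_mono) auto
  finally have "(p * e 1) / ((1 - p) * N) \<le> e (Suc (Suc n)) - e (Suc n)"
    using p N by (simp add: pos_divide_le_eq mult.commute)
  moreover have "(p * e 1) / ((1 - p) * N) = e 1 * (p / (1 - p) * inverse N)"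
    by (simp add: field_simps)
  moreover have "0 \<le> e 1 * (p / (1 - p) * inverse N)"
    using e1 p N by (intro mult_nonneg_nonneg) auto
  ultimately show ?case
    using Suc by (simp add: harm_Suc N_def algebra_simps)
qed

text \<open>A positive \<open>e 1\<close> would bound the harmonic numbers. The one-sided conclusion
  suffices, because two solutions can be subtracted in either order.\<close>

lemma bounded_recurrence_nonpos:
  fixes e :: "nat \<Rightarrow> real"
  assumes p: "0 < p" "p < 1" and e0: "e 0 = 0" and bd: "bounded (range e)"
    and step: "\<And>k. (real (Suc k) + p) * e (Suc k)
      = p * real (Suc k) * e k + (1 - p) * real (Suc k) * e (Suc (Suc k))"
  shows "e 1 \<le> 0"
proof (rule ccontr)
  assume "\<not> e 1 \<le> 0"
  then have e1: "0 < e 1" by simp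
  obtain B where B: "\<And>n. \<bar>e n\<bar> \<le> B" using bd by (auto simp: bounded_iff)
  let ?a = "e 1 * (p / (1 - p))"
  have a: "0 < ?a" using e1 p by simp
  have "harm n \<le> B / ?a" for n
  proof -
    have "?a * harm n \<le> e 1 * (1 + p / (1 - p) * harm n)"
      using e1 by (simp add: algebra_simps)
    also have "\<dots> \<le> e (Suc n)"
      using recurrence_harm_bound[OF p e0 _ step] e1 by simp
    also have "\<dots> \<le> B" using B[of "Suc n"] by simp
    finally show ?thesis using a by (subst pos_le_divide_eq) (simp_all only: mult.commute)
  qed
  moreover have "\<forall>\<^sub>F n in sequentially. B / ?a < (harm n :: real)"
    using harm_at_top by (simp add: filterlim_at_top_dense)
  ultimately show False
    by (metis (no_types, lifting) eventually_sequentially le_refl not_le)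
qed

text \<open>A second-order recurrence is determined by its first two values: \<open>d 0\<close> is
  prescribed and boundedness forces \<open>d 1\<close>.\<close>

lemma positive_bounded_solution_unique:
  assumes p: "0 < p" "p < 1"
    and d: "positive_bounded_solution p d" and d': "positive_bounded_solution p d'"
  shows "d = d'"
proof -
  have le: "x 1 - y 1 \<le> 0"
    if x: "positive_bounded_solution p x" and y: "positive_bounded_solution p y" for x y
  proof (rule bounded_recurrence_nonpos[OF p, where e = "\<lambda>k. x k - y k"])
    show "x 0 - y 0 = 0" using x y by (simp add: positive_bounded_solution_def)
    show "bounded (range (\<lambda>k. x k - y k))"
      using x y by (intro bounded_minus_comp) (auto simp: positive_bounded_solution_def)
    show "(real (Suc k) + p) * (x (Suc k) - y (Suc k))
      = p * real (Suc k) * (x k - y k) + (1 - p) * real (Suc k) * (x (Suc (Suc k)) - y (Suc (Suc k)))" for k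
      using solution_step[OF x p(1), of k] solution_step[OF y p(1), of k] by (simp add: algebra_simps)
  qed
  have "d n = d' n \<and> d (Suc n) = d' (Suc n)" for n
  proof (induction n)
    case 0
    have "d 0 = d' 0" using d d' unfolding positive_bounded_solution_def by metis
    then show ?case using le[OF d d'] le[OF d' d] by simp
  next
    case (Suc n)
    then have "(1 - p) * real (Suc n) * d (Suc (Suc n)) = (1 - p) * real (Suc n) * d' (Suc (Suc n))"
      using solution_step[OF d p(1), of n] solution_step[OF d' p(1), of n] by simp
    then show ?case using Suc p by simp
  qed
  then show ?thesis by auto
qed

section \<open>Existence and the explicit formula\<close>

lemma euler_integral_solution:
  fixes p :: real
  assumes p: "0 < p" "p < 1 / 2"
  defines "b \<equiv> p / (2 * p - 1)" and "c \<equiv> p / (1 - p)"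
  shows "positive_bounded_solution p (\<lambda>k. c ^ k * euler_integral b c k)"
proof -
  have bc: "b < 0" "0 < c" "c < 1"
    using p by (auto simp: b_def c_def divide_simps)
  \<comment> \<open>The choice of \<open>b\<close> enters here: this identity yields both the
    initial value \<open>1 / c\<close> and the term \<open>p\<close> in the denominator
    \<open>k + p\<close>.\<close>
  have const: "- b * (1 - c) = c"
    using p by (simp add: b_def c_def divide_simps) (simp add: algebra_simps)
  show ?thesis
    unfolding positive_bounded_solution_def
  proof (intro conjI allI impI)
    show "0 < c ^ k * euler_integral b c k" for k
      using bc euler_integral_pos[OF bc] by simp
    have "c ^ k * euler_integral b c k \<le> 1 * euler_integral b c 0" for k
      using bc euler_integral_le[OF bc] euler_integral_pos[OF bc]
      by (intro mult_mono) (auto simp: power_le_one less_imp_le)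
    moreover have "0 \<le> c ^ k * euler_integral b c k" for k
      using bc euler_integral_pos[OF bc, of k] by simp
    ultimately show "bounded (range (\<lambda>k. c ^ k * euler_integral b c k))"
      unfolding bounded_iff by (intro exI[of _ "euler_integral b c 0"]) auto
    show "c ^ 0 * euler_integral b c 0 = (1 - p) / p"
      unfolding euler_integral_0[OF bc] const by (simp add: c_def)
    fix k :: nat assume "1 \<le> k"
    then obtain m where k: "k = Suc m" by (cases k) auto
    define N where "N = real (Suc m)"
    define x y z where "x = euler_integral b c m" and "y = euler_integral b c (Suc m)"
      and "z = euler_integral b c (Suc (Suc m))"
    have "N * (x - (1 + c) * y + c * z) = c * y"
      using euler_integral_recurrence[OF bc, of m] unfolding const N_def x_def y_def z_def .
    then have "(1 - p) * (N * (x - (1 + c) * y + c * z)) = (1 - p) * (c * y)" by simp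
    moreover have pc: "p = c * (1 - p)" using p by (simp add: c_def)
    \<comment> \<open>Here \<open>(1 - p) * (1 + c) = 1\<close> and
      \<open>(1 - p) * c = p\<close>.\<close>
    ultimately have rec: "(N + p) * y = (1 - p) * N * x + (1 - p) * c * N * z"
      by algebra
    have "(N + p) * (c * y) = p * N * x + (1 - p) * N * (c * c * z)"
      using rec pc by algebra
    then have "c ^ m * ((N + p) * (c * y)) = c ^ m * (p * N * x + (1 - p) * N * (c * c * z))"
      by (rule arg_cong)
    then have "(N + p) * (c ^ Suc m * y) = p * N * (c ^ m * x) + (1 - p) * N * (c ^ Suc (Suc m) * z)"
      by (simp add: algebra_simps)
    moreover have "N + p \<noteq> 0" using p by (simp add: N_def)
    ultimately show "c ^ k * euler_integral b c k
      = (p * real k * (c ^ (k - 1) * euler_integral b c (k - 1))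
         + (1 - p) * real k * (c ^ (k + 1) * euler_integral b c (k + 1))) / (real k + p)"
      by (simp add: k N_def[symmetric] x_def[symmetric] y_def[symmetric] z_def[symmetric]
          nonzero_eq_divide_eq mult.commute del: power_Suc of_nat_Suc)
  qed
qed

theorem theorem4p2:
  fixes p \<beta> \<gamma> :: real
  assumes "0 < p" and "p < 1 / 2"
    and "\<beta> = p / (2 * p - 1)" and "\<gamma> = (1 - p) / p"
  shows "(\<exists>!d. positive_bounded_solution p d) \<and>
    (\<forall>d. positive_bounded_solution p d \<longrightarrow>
      (\<forall>k. (\<lambda>t. t ^ k * (1 - t) powr (- 1 - \<beta>) / (1 - \<gamma> powi (- 1) * t) powr (1 - \<beta>))
              integrable_on {0..1} \<and>
           d k = \<gamma> powi (- int k) *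
             integral {0..1}
               (\<lambda>t. t ^ k * (1 - t) powr (- 1 - \<beta>) / (1 - \<gamma> powi (- 1) * t) powr (1 - \<beta>))))"
proof -
  define c where "c = p / (1 - p)"
  \<comment> \<open>Negative \<open>powi\<close> exponents become natural powers of
    \<open>c\<close>, the inverse of \<open>\<gamma>\<close>.\<close>
  have c: "\<gamma> powi (- 1) = c" and ck: "\<gamma> powi (- int k) = c ^ k" for k
    by (simp_all add: power_int_minus c_def assms(4) flip: power_inverse)
  have bc: "\<beta> < 0" "0 < c" "c < 1"
    using assms(1,2) by (auto simp: assms(3) c_def divide_simps)
  have sol: "positive_bounded_solution p (\<lambda>k. c ^ k * euler_integral \<beta> c k)"
    using euler_integral_solution[OF assms(1,2)] by (simp add: assms(3) c_def)
  have uniq: "d = (\<lambda>k. c ^ k * euler_integral \<beta> c k)" if "positive_bounded_solution p d" for d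
    using positive_bounded_solution_unique[OF _ _ that sol] assms by simp
  show ?thesis
    unfolding c ck euler_integral_def[symmetric]
  proof (intro conjI allI impI)
    show "\<exists>!d. positive_bounded_solution p d"
      using sol uniq by blast
    show "d k = c ^ k * euler_integral \<beta> c k" if "positive_bounded_solution p d" for d k
      by (subst uniq[OF that]) (rule refl)
  qed (rule euler_integral_by_parts(1)[OF bc])
qed

end
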